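(* Let $q$ be a prime power. Brouwer's Conjecture is true for each of the following graphs $G$: (1) $G$ is the complement of the symplectic graph $Sp(2r,q)$, where $r\geq 2$ is an integer (this complement is a $\left(\frac{q^{2r}-1}{q-1},\frac{q^{2r-1}-q}{q-1},\frac{q^{2r-2}-1}{q-1}-2,\frac{q^{2r-2}-1}{q-1}\right)$-SRG); (2) $G$ is the point graph of a generalized quadrangle of order $(q,q)$ (this graph is a $((q+1)(q^2+1),q(q+1),q-1,q+1)$-SRG). That is, if $(v,k,\lambda,\mu)$ are the parameters of $G$ and $S$ is a disconnecting set of $G$ such that every component of $G\setminus S$ has at least two vertices, then $|S|\geq 2k-\lambda-2$.
   Context: All graphs are finite and simple. A graph $G$ is a $(v,k,\lambda,\mu)$-SRG (strongly regular graph) if it has $v$ vertices, is $k$-regular, any two adjacent vertices have exactly $\lambda$ common neighbors, and any two distinct non-adjacent vertices have exactly $\mu$ common neighbors. A disconnecting set of a connected graph $G$ is a set $S$ of vertices such that $G\setminus S$ is disconnected. The symplectic graph $Sp(2r,q)$: let $M$ be the $2r\times 2r$ block diagonal matrix over $\mathbb{F}_q$ all of whose diagonal blocks are $\begin{bmatrix}0&-1\\1&0\end{bmatrix}$. The vertices of $Sp(2r,q)$ are the $1$-dimensional subspaces $[x]$ of $\mathbb{F}_q^{2r}$ ($x$ a non-zero column vector), and $[x]\sim[y]$ if and only if $x^tMy\neq 0$. A generalized quadrangle of order $(s,t)$ is a pair $(P,L)$ of a finite set $P$ of points and a set $L\subseteq 2^P$ of lines such that any two distinct points lie on at most one common line,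 every line contains exactly $s+1$ points, every point is on exactly $t+1$ lines, and for every point $p$ and line $\ell$ with $p\notin\ell$, $p$ is collinear with exactly one point of $\ell$. Two distinct points are collinear if some line contains both. The point graph has vertex set $P$, with two distinct points adjacent when they are collinear. *)

theory Defs
  imports
    "Graph_Theory.Graph_Theory"
    "Jordan_Normal_Form.Matrix"
    "HOL-Library.Cardinality"
    "HOL-Number_Theory.Prime_Powers"
begin

definition neighbors :: "'v pair_pre_digraph \<Rightarrow> 'v \<Rightarrow> 'v set" where
  "neighbors G x = {y \<in> pverts G. (x, y) \<in> parcs G}"

(* pair_graph: finite, loop-free, symmetric, with arcs given as ordered pairs of vertices,
   i.e. a finite simple graph. *)
definition strongly_regular ::
    "'v pair_pre_digraph \<Rightarrow> nat \<Rightarrow> nat \<Rightarrow> nat \<Rightarrow> nat \<Rightarrow> bool" where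
  "strongly_regular G v k l m \<longleftrightarrow>
     pair_graph G \<and>
     card (pverts G) = v \<and>
     (\<forall>x \<in> pverts G. card (neighbors G x) = k) \<and>
     (\<forall>x \<in> pverts G. \<forall>y \<in> pverts G. (x, y) \<in> parcs G \<longrightarrow>
        card (neighbors G x \<inter> neighbors G y) = l) \<and>
     (\<forall>x \<in> pverts G. \<forall>y \<in> pverts G. x \<noteq> y \<and> (x, y) \<notin> parcs G \<longrightarrow>
        card (neighbors G x \<inter> neighbors G y) = m)"

definition graph_complement :: "'v pair_pre_digraph \<Rightarrow> 'v pair_pre_digraph" where
  "graph_complement G =
     \<lparr> pverts = pverts G,
       parcs = {(x, y). x \<in> pverts G \<and> y \<in> pverts G \<and> x \<noteq> y \<and> (x, y) \<notin> parcs G} \<rparr>"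

definition remove_vertices ::
    "'v pair_pre_digraph \<Rightarrow> 'v set \<Rightarrow> ('v, 'v \<times> 'v) pre_digraph" where
  "remove_vertices G S = with_proj G \<restriction> (pverts G - S)"

(* The null graph is not "connected" in the library's sense; it is not counted as
   disconnected either, so S may not exhaust the vertex set. *)
definition disconnecting_set :: "'v pair_pre_digraph \<Rightarrow> 'v set \<Rightarrow> bool" where
  "disconnecting_set G S \<longleftrightarrow>
     Digraph_Component.connected (with_proj G) \<and>
     S \<subseteq> pverts G \<and> S \<noteq> pverts G \<and>
     \<not> Digraph_Component.connected (remove_vertices G S)"

(* As G is symmetric, the strongly connected components (sccs) of G with S removed
   are its connected components.  The bound is taken in int to avoid truncated subtraction. *)
definition Brouwer_conjecture :: "'v pair_pre_digraph \<Rightarrow> bool" where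
  "Brouwer_conjecture G \<longleftrightarrow>
     (\<forall>v k l m S. strongly_regular G v k l m \<and> disconnecting_set G S \<and>
        (\<forall>C \<in> pre_digraph.sccs (remove_vertices G S). card (verts C) \<ge> 2) \<longrightarrow>
        int (card S) \<ge> 2 * int k - int l - 2)"

definition symplectic_mat :: "nat \<Rightarrow> 'a::field mat" where
  "symplectic_mat r = diag_block_mat (replicate r (mat_of_rows_list 2 [[0, -1], [1, 0]]))"

definition nonzero_vecs :: "nat \<Rightarrow> 'a::field vec set" where
  "nonzero_vecs n = carrier_vec n - {0\<^sub>v n}"

(* the subspace [x] spanned by x *)
definition proj_point :: "'a::field vec \<Rightarrow> 'a vec set" where
  "proj_point x = {c \<cdot>\<^sub>v x | c. True}"

(* Whether the form vanishes at (x, y) depends only on [x] and [y], so the choice of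
   representatives is immaterial; it vanishes at (x, x), so there are no loops. *)
definition symplectic_graph :: "nat \<Rightarrow> 'a::field vec set pair_pre_digraph" where
  "symplectic_graph r =
     \<lparr> pverts = proj_point ` nonzero_vecs (2 * r),
       parcs = {(proj_point x, proj_point y) | x y.
                  x \<in> nonzero_vecs (2 * r) \<and> y \<in> nonzero_vecs (2 * r) \<and>
                  x \<bullet> (symplectic_mat r *\<^sub>v y) \<noteq> 0} \<rparr>"

definition collinear_pts :: "'p set set \<Rightarrow> 'p \<Rightarrow> 'p \<Rightarrow> bool" where
  "collinear_pts L x y \<longleftrightarrow> x \<noteq> y \<and> (\<exists>l \<in> L. x \<in> l \<and> y \<in> l)"

(* The point set is required to be nonempty: P = L = {} would satisfy all the other
   conditions for every s and t. *)
definition generalized_quadrangle ::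
    "nat \<Rightarrow> nat \<Rightarrow> 'p set \<Rightarrow> 'p set set \<Rightarrow> bool" where
  "generalized_quadrangle s t P L \<longleftrightarrow>
     finite P \<and> P \<noteq> {} \<and> L \<subseteq> Pow P \<and>
     (\<forall>x \<in> P. \<forall>y \<in> P. x \<noteq> y \<longrightarrow>
        (\<forall>l \<in> L. \<forall>l' \<in> L. x \<in> l \<and> y \<in> l \<and> x \<in> l' \<and> y \<in> l' \<longrightarrow> l = l')) \<and>
     (\<forall>l \<in> L. card l = s + 1) \<and>
     (\<forall>p \<in> P. card {l \<in> L. p \<in> l} = t + 1) \<and>
     (\<forall>p \<in> P. \<forall>l \<in> L. p \<notin> l \<longrightarrow> (\<exists>!x. x \<in> l \<and> collinear_pts L p x))"

definition point_graph :: "'p set \<Rightarrow> 'p set set \<Rightarrow> 'p pair_pre_digraph" where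
  "point_graph P L =
     \<lparr> pverts = P, parcs = {(x, y). x \<in> P \<and> y \<in> P \<and> collinear_pts L x y} \<rparr>"

end

(* Both families satisfy k = q * mu and lambda = mu - 2, and this alone implies the bound.
   As lambda + 2 = mu, the closed neighbourhoods N[x] are the blocks of a symmetric design:
   with n = 1 + (q - 1) * mu, we have |N[x]| = k + 1, |N[x] Int N[y]| = mu for x ~= y,
   and (k + 1)^2 = n + mu * v.
   If S separates A from B, then d(x) = |N[x] Int A| vanishes on B.  Cauchy-Schwarz for d
   on the complement of B gives mu * |A| * |B| <= n * |S|.  Together with
   |A| + |B| + |S| = v and |A|, |B| >= 3 this forces |S| >= (2q - 1) * mu = 2k - lambda - 2.
   Otherwise one side is a single edge xy, and S contains (N(x) Un N(y)) - {x, y}. *)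
theory Submission
  imports Defs "HOL-Analysis.Convex" "HOL-Library.Product_Plus"
begin

section \<open>The cut bound for strongly regular graphs with lambda + 2 = mu\<close>

text \<open>Size 3 is the threshold of the counting argument. If |S| < (2q - 1) mu, then |A| + |B|
  >= 3 + (q - 1) n. For two sides of size at least 3 this gives |A| |B| >= 3 (q - 1) n >= (2q - 1)
  n, which contradicts the Cauchy-Schwarz bound. A side of size 2 guarantees only 2 + 2 (q - 1) n,
  which is below (2q - 1) n because n > 2; hence the separate treatment of a single edge. The vertex
  number is tied to the other parameters: the standard count k (k - lambda - 1) = (v - k - 1) mu
  with k = q mu and lambda = mu - 2 yields v = 1 + q + q^2 mu.\<close>

definition closed_nbhd :: "'v pair_pre_digraph \<Rightarrow> 'v \<Rightarrow> 'v set" where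
  "closed_nbhd G x = insert x (neighbors G x)"

text \<open>Double counting gives the first two moments of \<open>d\<close> over the vertex set. A
  pair y, z in \<open>A\<close> contributes the size of \<open>N y \<inter> N z\<close> to the
  second moment: \<open>k + 1\<close> on the diagonal and \<open>l + 2\<close> off it. The relation
  between k and mu enters later, so the inequality is kept in this raw form.\<close>

lemma design_cut_bound:
  assumes srg: "strongly_regular G v k l (l + 2)"
    and A: "A \<subseteq> pverts G" and B: "B \<subseteq> pverts G" and disj: "A \<inter> B = {}"
    and sep: "\<And>x y. x \<in> A \<Longrightarrow> y \<in> B \<Longrightarrow> (x, y) \<notin> parcs G"
  shows "(card A * (k + 1))\<^sup>2 \<le>
    (card A * (k + 1) + card A * (card A - 1) * (l + 2)) * (v - card B)"
proof -
  define V where "V = pverts G"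
  define N where "N = closed_nbhd G"
  define d where "d x = card (N x \<inter> A)" for x
  interpret pair_graph G
    using srg by (simp add: strongly_regular_def)
  have fin: "finite V" "finite A" "finite B"
    using pair_finite_verts A B by (auto simp: V_def intro: finite_subset)
  have NV: "N x \<subseteq> V" if "x \<in> V" for x
    using that by (auto simp: N_def closed_nbhd_def neighbors_def V_def)
  have nin: "x \<notin> neighbors G x" for x
    using pair_no_loops[of "(x, x)"] by (auto simp: neighbors_def)
  have finN: "finite (neighbors G x)" for x
    using pair_finite_verts by (simp add: neighbors_def)
  have symm: "(y, x) \<in> parcs G" if "(x, y) \<in> parcs G" for x y
    using that pair_sym_arcs by (auto simp: symmetric_conv)
  have sym: "x \<in> N y \<longleftrightarrow> y \<in> N x" if "x \<in> V" "y \<in> V" for x y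
    using that symm by (auto simp: N_def closed_nbhd_def neighbors_def V_def)
  have card_N: "card (N x) = k + 1" if "x \<in> V" for x
    using that srg nin finN by (simp add: N_def closed_nbhd_def strongly_regular_def V_def)
  \<comment> \<open>Adjacent x and y both lie in the intersection and add 2 to their
    \<open>l\<close> common neighbours; non-adjacent ones add nothing to their \<open>l + 2\<close>.
    This is where lambda + 2 = mu is used.\<close>
  have card_N2: "card (N x \<inter> N y) = l + 2" if "x \<in> V" "y \<in> V" "x \<noteq> y" for x y
  proof (cases "(x, y) \<in> parcs G")
    case True
    then have "N x \<inter> N y = insert x (insert y (neighbors G x \<inter> neighbors G y))"
      using that symm[OF True] by (auto simp: N_def closed_nbhd_def neighbors_def V_def)
    moreover have "card (neighbors G x \<inter> neighbors G y) = l"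
      using that srg True by (auto simp: strongly_regular_def V_def)
    ultimately show ?thesis using that nin finN by simp
  next
    case False
    then have "N x \<inter> N y = neighbors G x \<inter> neighbors G y"
      using that symm by (auto simp: N_def closed_nbhd_def neighbors_def V_def)
    then show ?thesis
      using that srg False by (auto simp: strongly_regular_def V_def)
  qed
  \<comment> \<open>By symmetry of \<open>N\<close>, the points of \<open>A\<close> in the block of
    x correspond to the blocks indexed by \<open>A\<close> that contain x, so the order of summation
    can be exchanged.\<close>
  have d_eq: "d x = (\<Sum>y\<in>A. of_bool (x \<in> N y))" if "x \<in> V" for x
  proof -
    have "A \<inter> {y. x \<in> N y} = N x \<inter> A" using A that sym by (auto simp: V_def)
    then show ?thesis using fin by (simp add: d_def)
  qed
  have cardV: "(\<Sum>x\<in>V. of_bool (x \<in> S)) = card S" if "S \<subseteq> V" for S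
    using that fin by (simp add: Int_absorb1)
  have sum_d: "(\<Sum>x\<in>V. d x) = card A * (k + 1)"
  proof -
    have "(\<Sum>x\<in>V. d x) = (\<Sum>x\<in>V. \<Sum>y\<in>A. of_bool (x \<in> N y))"
      by (simp add: d_eq)
    also have "\<dots> = (\<Sum>y\<in>A. \<Sum>x\<in>V. of_bool (x \<in> N y))"
      by (rule sum.swap)
    also have "\<dots> = (\<Sum>y\<in>A. k + 1)"
    proof (rule sum.cong[OF refl])
      fix y assume "y \<in> A"
      then have y: "y \<in> V" using A by (auto simp: V_def)
      show "(\<Sum>x\<in>V. of_bool (x \<in> N y)) = k + 1"
        unfolding cardV[OF NV[OF y]] by (rule card_N[OF y])
    qed
    finally show ?thesis by simp
  qed
  have sum_d2: "(\<Sum>x\<in>V. (d x)\<^sup>2) = card A * (k + 1) + card A * (card A - 1) * (l + 2)"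
  proof -
    have "(\<Sum>x\<in>V. (d x)\<^sup>2) =
        (\<Sum>x\<in>V. \<Sum>y\<in>A. \<Sum>z\<in>A. of_bool (x \<in> N y \<inter> N z))"
    proof (rule sum.cong[OF refl])
      fix x assume "x \<in> V"
      then show "(d x)\<^sup>2 = (\<Sum>y\<in>A. \<Sum>z\<in>A. of_bool (x \<in> N y \<inter> N z))"
        by (simp only: d_eq power2_eq_square sum_product) (simp add: of_bool_conj)
    qed
    also have "\<dots> = (\<Sum>y\<in>A. \<Sum>x\<in>V. \<Sum>z\<in>A. of_bool (x \<in> N y \<inter> N z))"
      by (rule sum.swap)
    also have "\<dots> = (\<Sum>y\<in>A. \<Sum>z\<in>A. \<Sum>x\<in>V. of_bool (x \<in> N y \<inter> N z))"
      by (intro sum.cong[OF refl] sum.swap)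
    also have "\<dots> = (\<Sum>y\<in>A. \<Sum>z\<in>A. card (N y \<inter> N z))"
    proof (intro sum.cong[OF refl])
      fix y z assume "y \<in> A" "z \<in> A"
      then have "N y \<inter> N z \<subseteq> V" using A NV by (auto simp: V_def)
      then show "(\<Sum>x\<in>V. of_bool (x \<in> N y \<inter> N z)) = card (N y \<inter> N z)"
        by (rule cardV)
    qed
    also have "\<dots> = (\<Sum>y\<in>A. (k + 1) + (card A - 1) * (l + 2))"
    proof (rule sum.cong[OF refl])
      fix y assume y: "y \<in> A"
      have "(\<Sum>z\<in>A. card (N y \<inter> N z)) =
          card (N y \<inter> N y) + (\<Sum>z\<in>A - {y}. card (N y \<inter> N z))"
        using fin(2) y by (rule sum.remove)
      also have "(\<Sum>z\<in>A - {y}. card (N y \<inter> N z)) = (\<Sum>z\<in>A - {y}. l + 2)"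
        using y A by (intro sum.cong[OF refl] card_N2) (auto simp: V_def)
      finally show "(\<Sum>z\<in>A. card (N y \<inter> N z)) = (k + 1) + (card A - 1) * (l + 2)"
        using y A card_N[of y] fin by (auto simp: V_def)
    qed
    finally show ?thesis by (simp add: algebra_simps)
  qed
  have d_B: "d x = 0" if "x \<in> B" for x
  proof -
    have "N x \<inter> A = {}"
      using that sep symm disj by (auto simp: N_def closed_nbhd_def neighbors_def)
    then show ?thesis by (simp add: d_def)
  qed
  \<comment> \<open>Both moments are already attained on \<open>V - B\<close>; applying
    Cauchy-Schwarz there replaces the factor v by v - |B|.\<close>
  have restrict: "(\<Sum>x\<in>V. f (d x)) = (\<Sum>x\<in>V - B. f (d x))" if "f 0 = 0" for f :: "nat \<Rightarrow> nat"
    using that d_B fin B by (intro sum.mono_neutral_right) (auto simp: V_def)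
  have cardVB: "card (V - B) = v - card B"
    using srg B fin by (simp add: card_Diff_subset V_def strongly_regular_def)
  have "(\<Sum>x\<in>V - B. real (d x))\<^sup>2 \<le> (\<Sum>x\<in>V - B. (real (d x))\<^sup>2) * card (V - B)"
    by (rule sum_squared_le_sum_of_squares)
  then have "real ((\<Sum>x\<in>V - B. d x)\<^sup>2) \<le> real ((\<Sum>x\<in>V - B. (d x)\<^sup>2) * card (V - B))"
    by simp
  then have "(\<Sum>x\<in>V - B. d x)\<^sup>2 \<le> (\<Sum>x\<in>V - B. (d x)\<^sup>2) * card (V - B)"
    by (simp only: of_nat_le_iff)
  then show ?thesis
    using restrict[of "\<lambda>x. x"] restrict[of "\<lambda>x. x\<^sup>2"] by (simp only: sum_d sum_d2 cardVB) simp
qed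

text \<open>Here \<open>a\<close>, \<open>b\<close>, \<open>s\<close> are the sizes of A, B and S,
  \<open>m\<close> is mu and \<open>q * m\<close> is k, so that \<open>(2 * q - 1) * m\<close> is 2k
  - lambda - 2. A small \<open>s\<close> makes \<open>a + b\<close>, and with it
  \<open>a * b\<close>, too large.\<close>

lemma design_cut_arith:
  fixes a b m n q s :: int
  assumes "q \<ge> 2" "m \<ge> 2" "a \<ge> 3" "b \<ge> 3"
    and n: "n = 1 + (q - 1) * m"
    and s: "a + b + s = 1 + q + q\<^sup>2 * m"
    and bound: "(a * (q * m + 1))\<^sup>2 \<le> (a * (q * m + 1) + a * (a - 1) * m) * (a + s)"
  shows "(2 * q - 1) * m \<le> s"
proof (rule ccontr)
  assume "\<not> (2 * q - 1) * m \<le> s"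
  then have small: "s + 1 \<le> (2 * q - 1) * m" by simp
  have npos: "n > 0" using assms(1,2) n by (simp add: add_pos_nonneg)
  \<comment> \<open>Since \<open>q * m + 1 - m = n\<close>, the second moment equals
    \<open>a * (n + a * m)\<close>, and a factor \<open>a\<close> cancels.\<close>
  have "a * (a * (q * m + 1)\<^sup>2) \<le> a * ((n + a * m) * (a + s))"
    using bound unfolding n by (simp add: algebra_simps power2_eq_square)
  then have "a * (q * m + 1)\<^sup>2 \<le> (n + a * m) * (a + s)"
    using assms(3) by simp
  moreover have "(q * m + 1)\<^sup>2 = n + m * (a + b + s)"
    unfolding s n by (simp add: algebra_simps power2_eq_square)
  ultimately have main: "a * b * m \<le> n * s"
    by (simp add: algebra_simps)
  \<comment> \<open>The constant 2 becomes 3 because \<open>s\<close> falls short of the bound by at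
    least 1; this 3 then exactly absorbs the 9 from \<open>(a - 3) * (b - 3)\<close>.\<close>
  have "1 + q + q\<^sup>2 * m - (2 * q - 1) * m = 2 + (q - 1) * n"
    unfolding n by (simp add: algebra_simps power2_eq_square)
  then have "3 + (q - 1) * n \<le> a + b"
    using small s by linarith
  moreover have "0 \<le> (a - 3) * (b - 3)" using assms by simp
  ultimately have "3 * ((q - 1) * n) \<le> a * b" by (simp add: algebra_simps)
  \<comment> \<open>The comparison of coefficients, 2q - 1 <= 3(q - 1), is precisely q >= 2.\<close>
  moreover have "(2 * q - 1) * n \<le> 3 * ((q - 1) * n)"
    using mult_right_mono[of "2 * q - 1" "3 * (q - 1)" n] assms(1) npos
    by (simp add: algebra_simps)
  ultimately have "(2 * q - 1) * n \<le> a * b" by linarith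
  then have "(2 * q - 1) * n * m \<le> n * s"
    using mult_right_mono[of "(2 * q - 1) * n" "a * b" m] assms(2) main by linarith
  then have "n * ((2 * q - 1) * m) \<le> n * s" by (simp add: algebra_simps)
  then show False using npos small by simp
qed

section \<open>From disconnecting sets to separations\<close>

text \<open>\<open>A\<close> is the component of one vertex and \<open>B\<close> collects all the
  others. The edge on each side records that no component is a single vertex, and it fills a side of
  size 2 completely.\<close>

lemma disconnecting_set_separation:
  assumes G: "pair_graph G" and dis: "disconnecting_set G S"
    and comps: "\<forall>C \<in> pre_digraph.sccs (remove_vertices G S). card (verts C) \<ge> 2"
  obtains A B where "A \<union> B = pverts G - S" "A \<inter> B = {}"
    "\<forall>x\<in>A. \<forall>y\<in>B. (x, y) \<notin> parcs G"
    "\<exists>x\<in>A. \<exists>y\<in>A. (x, y) \<in> parcs G" "\<exists>x\<in>B. \<exists>y\<in>B. (x, y) \<in> parcs G"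
proof -
  interpret pair_graph G by fact
  define H where "H = remove_vertices G S"
  have symm: "(y, x) \<in> parcs G" if "(x, y) \<in> parcs G" for x y
    using that pair_sym_arcs by (auto simp: symmetric_conv)
  have vH: "verts H = pverts G - S"
    and aH: "arcs_ends H = {(x, y) \<in> parcs G. x \<in> pverts G - S \<and> y \<in> pverts G - S}"
    by (auto simp: H_def remove_vertices_def arcs_ends_def arc_to_ends_def image_iff)
  interpret H: sym_digraph H
  proof
    show "symmetric H" using symm by (auto simp: symmetric_def aH sym_def)
  qed (auto simp: H_def remove_vertices_def)
  \<comment> \<open>As \<open>H\<close> is nonempty, the failure of strong connectivity must come
    from a pair \<open>u\<close>, \<open>w\<close> without a path.\<close>
  have "verts H \<noteq> {}" and nc: "\<not> Digraph_Component.connected H"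
    using dis unfolding vH by (auto simp: disconnecting_set_def H_def)
  moreover have "strongly_connected H \<Longrightarrow> Digraph_Component.connected H"
    by (auto simp: Digraph_Component.connected_def strongly_connected_def
        intro: H.reachable_mk_symmetricI)
  ultimately obtain u w where u: "u \<in> verts H" and w: "w \<in> verts H" "\<not> u \<rightarrow>\<^sup>*\<^bsub>H\<^esub> w"
    by (auto simp: strongly_connected_def)
  define A where "A = {x. u \<rightarrow>\<^sup>*\<^bsub>H\<^esub> x}"
  define B where "B = verts H - A"
  have Asub: "A \<subseteq> verts H" by (auto simp: A_def dest: H.reachable_in_verts)
  have step: "y \<in> A" if "x \<in> A" "(x, y) \<in> arcs_ends H" for x y
    using that unfolding A_def by (auto intro: H.reachable_adj_trans)
  have sep: "(x, y) \<notin> parcs G" if "x \<in> A" "y \<in> B" for x y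
    using that step[of x y] Asub by (auto simp: aH B_def vH)
  \<comment> \<open>A vertex without arcs would form a strongly connected component of size
    1.\<close>
  have nbr: "\<exists>y. (x, y) \<in> arcs_ends H" if x: "x \<in> verts H" for x
  proof (rule ccontr)
    assume "\<nexists>y. (x, y) \<in> arcs_ends H"
    then have "{y. x \<rightarrow>\<^sup>*\<^bsub>H\<^esub> y} \<subseteq> {x}"
      by (auto elim: H.converse_reachable_cases)
    then have "card {y. x \<rightarrow>\<^sup>*\<^bsub>H\<^esub> y} \<le> 1"
      using card_mono[of "{x}"] by fastforce
    moreover have "2 \<le> card {y. x \<rightarrow>\<^sup>*\<^bsub>H\<^esub> y}"
      using comps H.induce_reachable_is_in_sccs[OF x] by (force simp: H_def)
    ultimately show False by simp
  qed
  show ?thesis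
  proof (rule that[of A B])
    show "A \<union> B = pverts G - S" using Asub by (auto simp: B_def vH)
    show "A \<inter> B = {}" by (auto simp: B_def)
    show "\<forall>x\<in>A. \<forall>y\<in>B. (x, y) \<notin> parcs G" using sep by blast
    have "u \<in> A" using u by (simp add: A_def)
    then show "\<exists>x\<in>A. \<exists>y\<in>A. (x, y) \<in> parcs G"
      using nbr[OF u] step by (auto simp: aH)
    have wB: "w \<in> B" using w by (simp add: B_def A_def)
    obtain y where y: "(w, y) \<in> arcs_ends H" using nbr[OF w(1)] by blast
    then have "y \<in> B"
      using sep[of y w] wB symm[of w y] by (auto simp: B_def aH vH)
    then show "\<exists>x\<in>B. \<exists>y\<in>B. (x, y) \<in> parcs G" using wB y by (auto simp: aH)
  qed
qed

text \<open>By inclusion-exclusion the two neighbourhoods cover 2k - l vertices, and at most x and y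
  among these lie outside \<open>S\<close>. The additive form avoids truncated subtraction.\<close>

lemma edge_component_bound:
  assumes srg: "strongly_regular G v k l m" and "A = {x, y}" "(x, y) \<in> parcs G"
    and fS: "finite S" and out: "\<And>x y. x \<in> A \<Longrightarrow> (x, y) \<in> parcs G \<Longrightarrow> y \<in> A \<union> S"
  shows "2 * k \<le> card S + l + 2"
proof -
  interpret pair_graph G using srg by (simp add: strongly_regular_def)
  have V: "x \<in> pverts G" "y \<in> pverts G" using assms(3) by (auto dest: in_arcsD1 in_arcsD2)
  have finN: "finite (neighbors G z)" for z
    using pair_finite_verts by (simp add: neighbors_def)
  have "neighbors G x \<union> neighbors G y \<subseteq> insert x (insert y S)"
    using out assms(2) by (auto simp: neighbors_def)
  then have "card (neighbors G x \<union> neighbors G y) \<le> card (insert x (insert y S))"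
    using fS by (intro card_mono) auto
  also have "\<dots> \<le> card S + 2"
    using fS by (simp add: card_insert_if)
  finally have "card (neighbors G x \<union> neighbors G y) \<le> card S + 2" .
  moreover have "card (neighbors G x) + card (neighbors G y) =
      card (neighbors G x \<union> neighbors G y) + card (neighbors G x \<inter> neighbors G y)"
    using finN by (intro card_Un_Int)
  ultimately show ?thesis
    using V srg assms(3) by (simp add: strongly_regular_def)
qed

text \<open>Writing mu as \<open>l + 2\<close> expresses lambda = mu - 2 without truncation and
  supplies mu >= 2 for the arithmetic.\<close>

theorem Brouwer_conjectureI:
  assumes srg: "strongly_regular G (1 + q + q\<^sup>2 * (l + 2)) (q * (l + 2)) l (l + 2)" and "q \<ge> 2"
  shows "Brouwer_conjecture G"
  unfolding Brouwer_conjecture_def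
proof (intro allI impI, elim conjE)
  fix v' k' l' m' S
  assume srg': "strongly_regular G v' k' l' m'" and dis: "disconnecting_set G S"
    and comps: "\<forall>C \<in> pre_digraph.sccs (remove_vertices G S). card (verts C) \<ge> 2"
  define s where "s = card S"
  interpret pair_graph G using srg by (simp add: strongly_regular_def)
  have symm: "(y, x) \<in> parcs G" if "(x, y) \<in> parcs G" for x y
    using that pair_sym_arcs by (auto simp: symmetric_conv)
  obtain A B where AB: "A \<union> B = pverts G - S" "A \<inter> B = {}"
    "\<forall>x\<in>A. \<forall>y\<in>B. (x, y) \<notin> parcs G"
    and edges: "\<exists>x\<in>A. \<exists>y\<in>A. (x, y) \<in> parcs G" "\<exists>x\<in>B. \<exists>y\<in>B. (x, y) \<in> parcs G"
    using disconnecting_set_separation[OF pair_graph_axioms dis comps] by blast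
  then obtain x y where xy: "x \<in> pverts G" "y \<in> pverts G" "(x, y) \<in> parcs G" by blast
  \<comment> \<open>\<open>Brouwer_conjecture\<close> ranges over all parameter tuples that fit
    \<open>G\<close>. A vertex determines k, and an edge determines lambda.\<close>
  have kl: "k' = q * (l + 2)" "l' = l"
    using srg srg' xy unfolding strongly_regular_def by metis+
  have SV: "S \<subseteq> pverts G" using dis by (simp add: disconnecting_set_def)
  have fin: "finite S" "finite A" "finite B"
    using pair_finite_verts SV AB(1) by (metis finite_subset finite_Un finite_Diff)+
  have edge2: "2 * (q * (l + 2)) \<le> card S + l + 2"
    if C: "C = A \<or> C = B" "card C = 2" for C
  proof -
    obtain x y where e: "x \<in> C" "y \<in> C" "(x, y) \<in> parcs G" using edges C(1) by blast
    have "x \<noteq> y" using pair_no_loops[OF e(3)] by simp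
    then have "C = {x, y}"
      using e C(2) by (auto simp: card_2_iff)
    then show ?thesis
    proof (rule edge_component_bound[OF srg _ e(3) fin(1)])
      fix x y assume "x \<in> C" "(x, y) \<in> parcs G"
      then show "y \<in> C \<union> S"
        using C(1) AB symm[of x y] in_arcsD2[of x y] by blast
    qed
  qed
  have ge2: "card C \<ge> 2" if C: "C = A \<or> C = B" for C
  proof -
    obtain x y where e: "x \<in> C" "y \<in> C" "(x, y) \<in> parcs G" using edges C by blast
    have "x \<noteq> y" using pair_no_loops[OF e(3)] by simp
    then have "card {x, y} \<le> card C" using e fin C by (intro card_mono) auto
    then show ?thesis using \<open>x \<noteq> y\<close> by simp
  qed
  have "2 * (q * (l + 2)) \<le> card S + l + 2"
  proof (cases "card A = 2 \<or> card B = 2")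
    case True
    then show ?thesis using edge2 by blast
  next
    case False
    then have ge3: "card A \<ge> 3" "card B \<ge> 3" using ge2[of A] ge2[of B] by auto
    have sub: "A \<subseteq> pverts G" "B \<subseteq> pverts G" using AB by auto
    have "pverts G = (A \<union> B) \<union> S" "(A \<union> B) \<inter> S = {}" using AB(1) SV by auto
    then have "card (pverts G) = card A + card B + card S"
      using fin AB(2) by (simp add: card_Un_disjoint)
    then have v: "card A + card B + card S = 1 + q + q\<^sup>2 * (l + 2)"
      using srg by (simp add: strongly_regular_def)
    then have vB: "1 + q + q\<^sup>2 * (l + 2) - card B = card A + card S" by simp
    note bound = design_cut_bound[OF srg sub AB(2) AB(3)[rule_format], unfolded vB]
    have "(2 * int q - 1) * int (l + 2) \<le> int (card S)"
    proof (rule design_cut_arith[OF _ _ _ _ refl])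
      show "int (card A) + int (card B) + int (card S) = 1 + int q + (int q)\<^sup>2 * int (l + 2)"
        using arg_cong[OF v, of int] by (simp add: algebra_simps)
      have "int (card A - 1) = int (card A) - 1" using ge3 by simp
      then show "(int (card A) * (int q * int (l + 2) + 1))\<^sup>2
          \<le> (int (card A) * (int q * int (l + 2) + 1) + int (card A) * (int (card A) - 1) * int (l + 2))
            * (int (card A) + int (card S))"
        using iffD2[OF of_nat_le_iff[where 'a = int] bound]
        by (simp only: of_nat_power of_nat_mult of_nat_add of_nat_1)
    qed (use ge3 \<open>q \<ge> 2\<close> in auto)
    then have "int (2 * (q * (l + 2))) \<le> int (card S + l + 2)"
      by (simp add: algebra_simps)
    then show ?thesis by linarith
  qed
  then show "2 * int k' - int l' - 2 \<le> int (card S)"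
    unfolding kl by linarith
qed

section \<open>Generalized quadrangles\<close>

text \<open>All counts rest on projection: a point off a line is collinear with exactly one point of
  it. If \<open>s = 0\<close> no two points are collinear, so the truncated \<open>s - 1\<close>
  concerns no pair.\<close>

lemma generalized_quadrangle_strongly_regular:
  fixes P :: "'p set"
  assumes gq: "generalized_quadrangle s t P L"
  shows "strongly_regular (point_graph P L) ((s + 1) * (s * t + 1)) (s * (t + 1)) (s - 1) (t + 1)"
proof -
  define adj where "adj = collinear_pts L"
  define G where "G = point_graph P L"
  define N where "N x = {y \<in> P. adj x y}" for x
  have fP: "finite P" and ne: "P \<noteq> {}" and LP: "\<And>l. l \<in> L \<Longrightarrow> l \<subseteq> P"
    and uniq: "\<And>x y l l'. x \<in> P \<Longrightarrow> y \<in> P \<Longrightarrow> x \<noteq> y \<Longrightarrow> l \<in> L \<Longrightarrow> l' \<in> L \<Longrightarrow>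
      x \<in> l \<Longrightarrow> y \<in> l \<Longrightarrow> x \<in> l' \<Longrightarrow> y \<in> l' \<Longrightarrow> l = l'"
    and cl: "\<And>l. l \<in> L \<Longrightarrow> card l = s + 1"
    and cp: "\<And>p. p \<in> P \<Longrightarrow> card {l \<in> L. p \<in> l} = t + 1"
    and ax: "\<And>p l. p \<in> P \<Longrightarrow> l \<in> L \<Longrightarrow> p \<notin> l \<Longrightarrow> \<exists>!x. x \<in> l \<and> adj p x"
    using gq unfolding generalized_quadrangle_def adj_def by (auto simp: Pow_def)
  have fL: "finite L"
    using fP LP by (meson Pow_iff finite_Pow_iff finite_subset subsetI)
  have fl: "finite l" if "l \<in> L" for l using LP[OF that] fP by (rule finite_subset)
  have adj_sym: "adj x y \<longleftrightarrow> adj y x" for x y by (auto simp: adj_def collinear_pts_def)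
  have adj_irrefl: "\<not> adj x x" for x by (simp add: adj_def collinear_pts_def)
  have adjI: "adj x y" if "x \<noteq> y" "l \<in> L" "x \<in> l" "y \<in> l" for x y l
    using that by (auto simp: adj_def collinear_pts_def)
  have nb: "neighbors G x = N x" if "x \<in> P" for x
    using that by (auto simp: neighbors_def G_def point_graph_def N_def adj_def)
  have fN: "finite (N x)" for x using fP by (simp add: N_def)
  have deg: "card (N x) = s * (t + 1)" if x: "x \<in> P" for x
  proof -
    \<comment> \<open>The t + 1 lines through x meet only in x; without x each contributes s
      points.\<close>
    have "N x = (\<Union>l\<in>{l \<in> L. x \<in> l}. l - {x})"
      using LP by (auto simp: N_def adj_def collinear_pts_def)
    also have "card \<dots> = (\<Sum>l\<in>{l \<in> L. x \<in> l}. card (l - {x}))"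
    proof (rule card_UN_disjoint)
      show "\<forall>i\<in>{l \<in> L. x \<in> l}. \<forall>j\<in>{l \<in> L. x \<in> l}. i \<noteq> j \<longrightarrow> (i - {x}) \<inter> (j - {x}) = {}"
        using uniq[OF x] LP by blast
    qed (use fL fl in auto)
    also have "\<dots> = (\<Sum>l\<in>{l \<in> L. x \<in> l}. s)"
      using cl fl by (intro sum.cong) auto
    finally show ?thesis using cp[OF x] by simp
  qed
  have lam: "card (N x \<inter> N y) = s - 1" if x: "x \<in> P" and y: "y \<in> P" and xy: "adj x y" for x y
  proof -
    obtain l where l: "l \<in> L" "x \<in> l" "y \<in> l" and "x \<noteq> y"
      using xy by (auto simp: adj_def collinear_pts_def)
    \<comment> \<open>A common neighbour off \<open>l\<close> would be collinear with two points of
      \<open>l\<close>, against uniqueness of the projection.\<close>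
    have "N x \<inter> N y = l - {x, y}"
    proof (intro equalityI subsetI)
      fix z assume z: "z \<in> N x \<inter> N y"
      have "z \<in> l"
      proof (rule ccontr)
        assume "z \<notin> l"
        then show False
          using ax[of z l] z l \<open>x \<noteq> y\<close> adj_sym by (auto simp: N_def)
      qed
      then show "z \<in> l - {x, y}" using z adj_irrefl by (auto simp: N_def)
    next
      fix z assume "z \<in> l - {x, y}"
      then show "z \<in> N x \<inter> N y"
        using l LP[OF l(1)] adjI[of x z l] adjI[of y z l] by (auto simp: N_def)
    qed
    then show ?thesis using cl[OF l(1)] l \<open>x \<noteq> y\<close> fl by (simp add: card_Diff_subset)
  qed
  have mu: "card (N x \<inter> N y) = t + 1"
    if x: "x \<in> P" and y: "y \<in> P" and "x \<noteq> y" and nadj: "\<not> adj x y" for x y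
  proof -
    have yl: "y \<notin> l" if "l \<in> L" "x \<in> l" for l
      using that adjI \<open>x \<noteq> y\<close> nadj by blast
    \<comment> \<open>\<open>f\<close> projects \<open>y\<close> onto each line through
      \<open>x\<close>. Its inverse sends a common neighbour to the line joining it to
      \<open>x\<close>.\<close>
    define f where "f l = (THE z. z \<in> l \<and> adj y z)" for l
    have f: "f l \<in> l" "adj y (f l)" if "l \<in> L" "x \<in> l" for l
      using theI'[OF ax[OF y that(1) yl[OF that]]] by (auto simp: f_def)
    have f_eq: "f l = z" if "l \<in> L" "x \<in> l" "z \<in> l" "adj y z" for l z
      using ax[OF y that(1) yl[OF that(1,2)]] that f[OF that(1,2)] by blast
    have fx: "f l \<noteq> x" if "l \<in> L" "x \<in> l" for l
      using f[OF that] nadj adj_sym by auto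
    have "bij_betw f {l \<in> L. x \<in> l} (N x \<inter> N y)"
    proof (rule bij_betwI')
      fix l l' assume l: "l \<in> {l \<in> L. x \<in> l}" "l' \<in> {l \<in> L. x \<in> l}"
      then have "f l \<in> P" using f LP by blast
      then show "f l = f l' \<longleftrightarrow> l = l'"
        using l uniq[of x "f l" l l'] x f[of l] f[of l'] fx[of l] by auto
    next
      fix l assume "l \<in> {l \<in> L. x \<in> l}"
      then show "f l \<in> N x \<inter> N y"
        using f[of l] fx[of l] LP adjI[of x "f l" l] by (auto simp: N_def)
    next
      fix z assume z: "z \<in> N x \<inter> N y"
      then obtain l where "l \<in> L" "x \<in> l" "z \<in> l"
        by (auto simp: N_def adj_def collinear_pts_def)
      then show "\<exists>l\<in>{l \<in> L. x \<in> l}. z = f l"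
        using f_eq[of l z] z by (auto simp: N_def)
    qed
    then show ?thesis using cp[OF x] bij_betw_same_card by metis
  qed
  have num: "card P = (s + 1) * (s * t + 1)"
  proof -
    obtain p where p: "p \<in> P" using ne by blast
    have "{l \<in> L. p \<in> l} \<noteq> {}" using cp[OF p] by (metis add_is_0 card.empty one_neq_zero)
    then obtain l where l: "l \<in> L" by blast
    \<comment> \<open>Projection onto \<open>l\<close> partitions the points off \<open>l\<close>.
      Of the s(t + 1) neighbours of a point of \<open>l\<close>, s lie on \<open>l\<close>, which
      leaves st in its class.\<close>
    have "\<exists>z\<in>l. adj z y" if "y \<in> P" "y \<notin> l" for y
      using ax[OF that(1) l that(2)] adj_sym by blast
    then have "P - l = (\<Union>z\<in>l. N z - l)"
      by (auto simp: N_def)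
    also have "card \<dots> = (\<Sum>z\<in>l. card (N z - l))"
    proof (rule card_UN_disjoint)
      show "\<forall>i\<in>l. \<forall>j\<in>l. i \<noteq> j \<longrightarrow> (N i - l) \<inter> (N j - l) = {}"
        using ax[OF _ l] adj_sym by (fastforce simp: N_def)
    qed (use fl[OF l] fN in auto)
    also have "\<dots> = (\<Sum>z\<in>l. s * t)"
    proof (rule sum.cong[OF refl])
      fix z assume z: "z \<in> l"
      have "N z \<inter> l = l - {z}"
        using LP[OF l] adjI[OF _ l z] adj_irrefl by (auto simp: N_def)
      then have "card (N z \<inter> l) = s" using cl[OF l] z fl[OF l] by simp
      moreover have "card (N z - l) = card (N z) - card (N z \<inter> l)"
        using fN by (simp add: card_Diff_subset_Int)
      ultimately show "card (N z - l) = s * t"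
        using deg[of z] z LP[OF l] by (auto simp: algebra_simps)
    qed
    finally have "card (P - l) = (s + 1) * (s * t)" using cl[OF l] by simp
    moreover have "card P = card l + card (P - l)"
      using fP LP[OF l] by (metis card_Diff_subset card_mono fl[OF l] le_add_diff_inverse)
    ultimately show ?thesis using cl[OF l] by simp
  qed
  have "pair_graph G"
  proof
    show "finite (pverts G)" using fP by (simp add: G_def point_graph_def)
    show "finite (parcs G)"
      by (rule finite_subset[of _ "P \<times> P"]) (use fP in \<open>auto simp: G_def point_graph_def\<close>)
    show "symmetric G"
      using adj_sym by (auto simp: symmetric_def sym_def G_def point_graph_def adj_def)
  qed (auto simp: G_def point_graph_def collinear_pts_def)
  then show ?thesis
    unfolding G_def[symmetric] strongly_regular_def
    using num deg lam mu nb by (simp add: G_def point_graph_def adj_def)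
qed

section \<open>Symplectic graphs\<close>

text \<open>This is x^t M y expanded block by block, with coordinates 2i and 2i + 1 forming block i.
  Bilinearity and alternation can be read off the sum; the matrix enters only through
  \<open>symplectic_form_eq\<close>.\<close>

definition symplectic_form :: "nat \<Rightarrow> 'a::field vec \<Rightarrow> 'a vec \<Rightarrow> 'a" where
  "symplectic_form r x y = (\<Sum>i<r. x $ (2 * i + 1) * y $ (2 * i) - x $ (2 * i) * y $ (2 * i + 1))"

lemma symplectic_mat_Suc:
  "symplectic_mat (Suc r) = four_block_mat (mat_of_rows_list 2 [[0, -1], [1, 0]])
     (0\<^sub>m 2 (2 * r)) (0\<^sub>m (2 * r) 2) (symplectic_mat r :: 'a::field mat)"
  and symplectic_mat_carrier: "(symplectic_mat r :: 'a mat) \<in> carrier_mat (2 * r) (2 * r)"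
proof -
  show car: "(symplectic_mat r :: 'a mat) \<in> carrier_mat (2 * r) (2 * r)" for r
    by (rule carrier_matI)
      (simp_all add: symplectic_mat_def dim_diag_block_mat sum_list_replicate mat_of_rows_list_def)
  show "symplectic_mat (Suc r) = four_block_mat (mat_of_rows_list 2 [[0, -1], [1, 0]])
     (0\<^sub>m 2 (2 * r)) (0\<^sub>m (2 * r) 2) (symplectic_mat r :: 'a mat)"
    using car[of r] by (simp add: symplectic_mat_def Let_def mat_of_rows_list_def numeral_2_eq_2)
qed

text \<open>Removing the first block shifts both indices by 2, which preserves their parities and
  their difference.\<close>

lemma symplectic_mat_index:
  assumes "i < 2 * r" "j < 2 * r"
  shows "(symplectic_mat r :: 'a::field mat) $$ (i, j) =
    (if even i \<and> j = i + 1 then -1 else if odd i \<and> i = j + 1 then 1 else 0)"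
  using assms
proof (induction r arbitrary: i j)
  case (Suc r)
  have car: "(symplectic_mat r :: 'a mat) \<in> carrier_mat (2 * r) (2 * r)"
    by (rule symplectic_mat_carrier)
  show ?case
  proof (cases "i < 2 \<or> j < 2")
    case True
    then show ?thesis
      using Suc.prems car
      by (auto simp: symplectic_mat_Suc mat_of_rows_list_def numeral_2_eq_2 less_Suc_eq)
  next
    case False
    then obtain i' j' where ij: "i = i' + 2" "j = j' + 2"
      by (metis add.commute le_Suc_ex not_less)
    then have "i' < 2 * r" "j' < 2 * r" using Suc.prems by auto
    then show ?thesis
      using Suc.IH[of i' j'] car by (auto simp: symplectic_mat_Suc mat_of_rows_list_def ij)
  qed
qed simp

lemma sum_double_split:
  fixes f :: "nat \<Rightarrow> 'b::comm_monoid_add"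
  shows "(\<Sum>i<2 * r. f i) = (\<Sum>i<r. f (2 * i) + f (2 * i + 1))"
  by (induction r) (simp_all add: add_ac)

lemma symplectic_form_eq:
  fixes x y :: "'a::field vec"
  assumes "x \<in> carrier_vec (2 * r)" "y \<in> carrier_vec (2 * r)"
  shows "x \<bullet> (symplectic_mat r *\<^sub>v y) = symplectic_form r x y"
proof -
  let ?M = "symplectic_mat r :: 'a mat"
  note car = carrier_matD[OF symplectic_mat_carrier[of r, where 'a = 'a]]
  have row: "(?M *\<^sub>v y) $ i = (\<Sum>j<2 * r. ?M $$ (i, j) * y $ j)" if "i < 2 * r" for i
    using that assms(2) car by (auto simp: scalar_prod_def lessThan_atLeast0)
  have even: "(?M *\<^sub>v y) $ (2 * i) = - y $ (2 * i + 1)" if "i < r" for i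
  proof -
    have "(?M *\<^sub>v y) $ (2 * i) = (\<Sum>j<2 * r. if j = 2 * i + 1 then - y $ (2 * i + 1) else 0)"
      unfolding row[of "2 * i", simplified, OF that]
      using that by (intro sum.cong) (auto simp: symplectic_mat_index)
    then show ?thesis using that by simp
  qed
  have odd: "(?M *\<^sub>v y) $ (2 * i + 1) = y $ (2 * i)" if "i < r" for i
  proof -
    have "2 * i + 1 < 2 * r" using that by simp
    then have "(?M *\<^sub>v y) $ (2 * i + 1) = (\<Sum>j<2 * r. if j = 2 * i then y $ (2 * i) else 0)"
      unfolding row[OF \<open>2 * i + 1 < 2 * r\<close>]
      using that by (intro sum.cong) (auto simp: symplectic_mat_index)
    then show ?thesis using that by simp
  qed
  have "x \<bullet> (?M *\<^sub>v y) = (\<Sum>i<2 * r. x $ i * (?M *\<^sub>v y) $ i)"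
    using car by (simp add: scalar_prod_def lessThan_atLeast0)
  also have "\<dots> = (\<Sum>i<r. x $ (2 * i) * (?M *\<^sub>v y) $ (2 * i) + x $ (2 * i + 1) * (?M *\<^sub>v y) $ (2 * i + 1))"
    by (rule sum_double_split)
  also have "\<dots> = symplectic_form r x y"
    unfolding symplectic_form_def by (intro sum.cong) (auto simp only: even odd lessThan_iff, simp)
  finally show ?thesis .
qed

lemma symplectic_form_self: "symplectic_form r x x = 0"
  by (simp add: symplectic_form_def mult.commute)

lemma symplectic_form_commute: "symplectic_form r y x = - symplectic_form r x y"
  by (simp add: symplectic_form_def flip: sum_negf) (simp add: algebra_simps)

lemma symplectic_form_linear:
  assumes "y \<in> carrier_vec (2 * r)" "z \<in> carrier_vec (2 * r)"
  shows "symplectic_form r x (y + z) = symplectic_form r x y + symplectic_form r x z"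
    and "symplectic_form r x (c \<cdot>\<^sub>v y) = c * symplectic_form r x y"
  using assms unfolding symplectic_form_def sum_distrib_left
  by (auto simp: algebra_simps simp flip: sum.distrib intro!: sum.cong)

lemma symplectic_form_linear_left:
  assumes "x \<in> carrier_vec (2 * r)" "z \<in> carrier_vec (2 * r)"
  shows "symplectic_form r (x + z) y = symplectic_form r x y + symplectic_form r z y"
    and "symplectic_form r (c \<cdot>\<^sub>v x) y = c * symplectic_form r x y"
  using assms unfolding symplectic_form_def sum_distrib_left
  by (auto simp: algebra_simps simp flip: sum.distrib intro!: sum.cong)

lemma symplectic_form_zero: "symplectic_form r x (0\<^sub>v (2 * r)) = 0"
  by (simp add: symplectic_form_def)

text \<open>A nonzero coordinate of \<open>x\<close> is extracted, up to sign, by the unit vector at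
  the other coordinate of its block.\<close>

lemma symplectic_form_nondegenerate:
  assumes x: "x \<in> carrier_vec (2 * r)" and "x \<noteq> 0\<^sub>v (2 * r)"
  obtains y where "y \<in> carrier_vec (2 * r)" "symplectic_form r x y \<noteq> 0"
proof -
  obtain i where i: "i < 2 * r" "x $ i \<noteq> 0"
    using assms by (metis eq_vecI carrier_vecD index_zero_vec)
  show ?thesis
  proof (cases "even i")
    case True
    then obtain k where k: "i = 2 * k" by blast
    have "symplectic_form r x (unit_vec (2 * r) (2 * k + 1)) =
        (\<Sum>j<r. if j = k then - x $ (2 * k) else 0)"
      unfolding symplectic_form_def using i k
      by (intro sum.cong) auto
    then show ?thesis using i k that[of "unit_vec (2 * r) (2 * k + 1)"] by auto
  next
    case False
    then obtain k where k: "i = 2 * k + 1" by (elim oddE)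
    have "symplectic_form r x (unit_vec (2 * r) (2 * k)) =
        (\<Sum>j<r. if j = k then x $ (2 * k + 1) else 0)"
      unfolding symplectic_form_def using i k
      by (intro sum.cong) auto
    then show ?thesis using i k that[of "unit_vec (2 * r) (2 * k)"] by auto
  qed
qed

section \<open>Counting vectors and projective points\<close>

lemma card_carrier_vec: "card (carrier_vec n :: 'a::finite vec set) = CARD('a) ^ n"
proof -
  have "bij_betw vec_of_list {xs :: 'a list. set xs \<subseteq> UNIV \<and> length xs = n} (carrier_vec n)"
    by (rule bij_betw_byWitness[of _ list_of_vec])
      (auto simp: list_vec vec_list intro!: carrier_vecI)
  then show ?thesis
    using card_lists_length_eq[of "UNIV :: 'a set" n] bij_betw_same_card by fastforce
qed

lemma finite_carrier_vec: "finite (carrier_vec n :: 'a::finite vec set)"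
  by (rule card_ge_0_finite) (simp add: card_carrier_vec)

text \<open>All fibres are translates of the kernel. The codomain is a general finite abelian group
  so that one functional and a pair of functionals are both covered; this count takes the place of a
  dimension argument.\<close>

lemma card_additive_kernel:
  fixes f :: "'a::{finite,field} vec \<Rightarrow> 'b::{finite,ab_group_add}"
  assumes add: "\<And>u v. u \<in> carrier_vec n \<Longrightarrow> v \<in> carrier_vec n \<Longrightarrow> f (u + v) = f u + f v"
    and surj: "f ` carrier_vec n = UNIV"
  shows "card {v \<in> carrier_vec n. f v = 0} * CARD('b) = CARD('a) ^ n"
proof -
  let ?V = "carrier_vec n :: 'a vec set"
  have fibre: "card {v \<in> ?V. f v = b} = card {v \<in> ?V. f v = 0}" for b
  proof -
    obtain w where w: "w \<in> ?V" "f w = b" using surj by (metis UNIV_I imageE)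
    have "bij_betw (\<lambda>v. v + w) {v \<in> ?V. f v = 0} {v \<in> ?V. f v = b}"
    proof (rule bij_betw_byWitness[of _ "\<lambda>v. v - w"])
      have cancel: "(v - w) + w = v" "(v + w) - w = v" if "v \<in> ?V" for v
        using that w by (auto intro!: eq_vecI)
      show "\<forall>v\<in>{v \<in> ?V. f v = 0}. v + w - w = v" "\<forall>v\<in>{v \<in> ?V. f v = b}. v - w + w = v"
        using cancel by auto
      show "(\<lambda>v. v + w) ` {v \<in> ?V. f v = 0} \<subseteq> {v \<in> ?V. f v = b}"
        using w add by auto
      have "f (v - w) = 0" if "v \<in> ?V" "f v = b" for v
        using add[of "v - w" w] that w cancel(1)[of v] by auto
      then show "(\<lambda>v. v - w) ` {v \<in> ?V. f v = b} \<subseteq> {v \<in> ?V. f v = 0}"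
        using w by auto
    qed
    then show ?thesis using bij_betw_same_card by force
  qed
  have "card ?V = (\<Sum>b\<in>f ` ?V. card {v \<in> ?V. f v = b})"
    unfolding card_eq_sum by (rule sum.image_gen[OF finite_carrier_vec])
  also have "\<dots> = (\<Sum>b\<in>(UNIV :: 'b set). card {v \<in> ?V. f v = 0})"
    unfolding surj by (rule sum.cong[OF refl fibre])
  finally show ?thesis by (simp add: card_carrier_vec mult.commute)
qed

lemma proj_point_eq_iff:
  assumes "x \<in> nonzero_vecs n" "y \<in> nonzero_vecs n"
  shows "proj_point x = proj_point y \<longleftrightarrow> (\<exists>c. c \<noteq> 0 \<and> y = c \<cdot>\<^sub>v x)"
proof
  have car: "x \<in> carrier_vec n" "y \<in> carrier_vec n" "y \<noteq> 0\<^sub>v n"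
    using assms by (auto simp: nonzero_vecs_def)
  {
    assume "proj_point x = proj_point y"
    moreover have "1 \<cdot>\<^sub>v y \<in> proj_point y" unfolding proj_point_def by blast
    ultimately obtain c where "y = c \<cdot>\<^sub>v x" by (auto simp: proj_point_def)
    moreover have "0 \<cdot>\<^sub>v x = 0\<^sub>v n" using car by (auto intro!: eq_vecI)
    ultimately show "\<exists>c. c \<noteq> 0 \<and> y = c \<cdot>\<^sub>v x" using car by metis
  next
    assume "\<exists>c. c \<noteq> 0 \<and> y = c \<cdot>\<^sub>v x"
    then obtain c where c: "c \<noteq> 0" "y = c \<cdot>\<^sub>v x" by blast
    have "d \<cdot>\<^sub>v x = (d / c) \<cdot>\<^sub>v y" for d using c by (simp add: smult_smult_assoc)
    moreover have "d \<cdot>\<^sub>v y = (d * c) \<cdot>\<^sub>v x" for d using c by (simp add: smult_smult_assoc)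
    ultimately show "proj_point x = proj_point y"
      unfolding proj_point_def by blast
  }
qed

lemma sum_powers_mult: "((q::nat) - 1) * (\<Sum>i<n. q ^ i) = q ^ n - 1"
proof (cases q)
  case (Suc p)
  have "p * (\<Sum>i<n. Suc p ^ i) + 1 = Suc p ^ n"
    by (induction n) (simp_all add: algebra_simps)
  then show ?thesis unfolding Suc by simp
qed (cases n, simp_all)

text \<open>Every point has q - 1 spanning vectors. The quotient (q^d - 1)/(q - 1) appears as a
  geometric sum, and subspaces are described by closure under scaling and a size that the kernel
  counts provide.\<close>

lemma card_proj_points:
  fixes W :: "'a::{finite,field} vec set"
  assumes W: "W \<subseteq> carrier_vec n" "0\<^sub>v n \<in> W" and smult: "\<And>c x. x \<in> W \<Longrightarrow> c \<cdot>\<^sub>v x \<in> W"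
    and card_W: "card W = CARD('a) ^ d"
  shows "card (proj_point ` (W - {0\<^sub>v n})) = (\<Sum>i<d. CARD('a) ^ i)"
proof -
  let ?q = "CARD('a)"
  let ?W = "W - {0\<^sub>v n}"
  have q: "?q \<ge> 2"
    using card_mono[of "UNIV :: 'a set" "{0, 1}"] by simp
  have fin: "finite W" using W(1) finite_carrier_vec by (rule finite_subset)
  have sub: "?W \<subseteq> nonzero_vecs n" using W by (auto simp: nonzero_vecs_def)
  have fibre: "card {y \<in> ?W. proj_point y = p} = ?q - 1" if p: "p \<in> proj_point ` ?W" for p
  proof -
    obtain x where x: "x \<in> ?W" "p = proj_point x" using p by blast
    have carx: "x \<in> carrier_vec n" "x \<noteq> 0\<^sub>v n" using x W by auto
    \<comment> \<open>The nonzero coordinate \<open>i\<close> recovers the scalar from a multiple of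
      \<open>x\<close>, so distinct scalars give distinct multiples.\<close>
    then obtain i where i: "i < n" "x $ i \<noteq> 0"
      by (metis eq_vecI carrier_vecD index_zero_vec)
    have "c \<cdot>\<^sub>v x \<noteq> 0\<^sub>v n" if "c \<noteq> 0" for c
      using i carx that by (metis carrier_vecD index_smult_vec(1) index_zero_vec(1) mult_eq_0_iff)
    then have multiples: "(\<lambda>c. c \<cdot>\<^sub>v x) ` (UNIV - {0}) \<subseteq> ?W" using x smult by auto
    have "proj_point y = p \<longleftrightarrow> (\<exists>c. c \<noteq> 0 \<and> y = c \<cdot>\<^sub>v x)" if "y \<in> ?W" for y
      using proj_point_eq_iff[of x n y] x that sub by auto
    then have "{y \<in> ?W. proj_point y = p} = (\<lambda>c. c \<cdot>\<^sub>v x) ` (UNIV - {0})"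
      using multiples by blast
    moreover have "inj_on (\<lambda>c. c \<cdot>\<^sub>v x) (UNIV - {0})"
    proof (rule inj_onI)
      fix c c' assume "c \<cdot>\<^sub>v x = c' \<cdot>\<^sub>v x"
      then have "(c \<cdot>\<^sub>v x) $ i = (c' \<cdot>\<^sub>v x) $ i" by simp
      then show "c = c'" using i carx by simp
    qed
    ultimately show ?thesis by (simp add: card_image card_Diff_subset)
  qed
  have "card ?W = (\<Sum>p\<in>proj_point ` ?W. card {y \<in> ?W. proj_point y = p})"
    unfolding card_eq_sum using fin by (intro sum.image_gen) simp
  also have "\<dots> = (\<Sum>p\<in>proj_point ` ?W. ?q - 1)"
    by (rule sum.cong[OF refl fibre])
  finally have "card ?W = (?q - 1) * card (proj_point ` ?W)" by (simp add: mult.commute)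
  then have "?q ^ d - 1 = (?q - 1) * card (proj_point ` ?W)"
    using W fin by (simp add: card_W)
  then have "(?q - 1) * card (proj_point ` ?W) = (?q - 1) * (\<Sum>i<d. ?q ^ i)"
    by (simp only: sum_powers_mult)
  moreover have "?q - 1 \<noteq> 0" using q by simp
  ultimately show ?thesis by (simp only: mult_cancel1) simp
qed

section \<open>Perpendicular subspaces\<close>

lemma symplectic_form_surj:
  assumes x: "x \<in> nonzero_vecs (2 * r)"
  shows "symplectic_form r x ` carrier_vec (2 * r) = UNIV"
proof -
  obtain u where u: "u \<in> carrier_vec (2 * r)" "symplectic_form r x u \<noteq> 0"
    using symplectic_form_nondegenerate x by (metis Diff_iff nonzero_vecs_def singletonI)
  have "b \<in> symplectic_form r x ` carrier_vec (2 * r)" for b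
    using u by (intro image_eqI[of _ _ "(b / symplectic_form r x u) \<cdot>\<^sub>v u"])
      (simp_all add: symplectic_form_linear)
  then show ?thesis by blast
qed

text \<open>If the functional of \<open>x\<close> vanished only where that of \<open>y\<close> does,
  the two functionals would be proportional, and nondegeneracy would make \<open>x\<close> and
  \<open>y\<close> proportional too.\<close>

lemma symplectic_form_separates:
  assumes x: "x \<in> nonzero_vecs (2 * r)" and y: "y \<in> nonzero_vecs (2 * r)"
    and neq: "proj_point x \<noteq> proj_point y"
  obtains u where "u \<in> carrier_vec (2 * r)" "symplectic_form r x u = 0" "symplectic_form r y u = 1"
proof -
  have car: "x \<in> carrier_vec (2 * r)" "y \<in> carrier_vec (2 * r)" "y \<noteq> 0\<^sub>v (2 * r)"
    using x y by (auto simp: nonzero_vecs_def)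
  have "\<exists>u \<in> carrier_vec (2 * r). symplectic_form r x u = 0 \<and> symplectic_form r y u \<noteq> 0"
  proof (rule ccontr)
    assume "\<not> ?thesis"
    then have ker: "symplectic_form r y v = 0"
      if "v \<in> carrier_vec (2 * r)" "symplectic_form r x v = 0" for v using that by blast
    obtain w where w: "w \<in> carrier_vec (2 * r)" "symplectic_form r x w = 1"
      using symplectic_form_surj[OF x] by (metis UNIV_I imageE)
    define c where "c = symplectic_form r y w"
    \<comment> \<open>Subtracting the multiple \<open>symplectic_form r x v\<close> of
      \<open>w\<close> moves \<open>v\<close> into the kernel of the first functional, because
      \<open>w\<close> has value 1 there.\<close>
    have y_eq: "symplectic_form r y v = c * symplectic_form r x v"
      if v: "v \<in> carrier_vec (2 * r)" for v
      using ker[of "v + (- symplectic_form r x v) \<cdot>\<^sub>v w"] v w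
      by (simp add: symplectic_form_linear c_def algebra_simps)
    have yc: "y = c \<cdot>\<^sub>v x"
    proof (rule ccontr)
      assume "y \<noteq> c \<cdot>\<^sub>v x"
      moreover have "y = c \<cdot>\<^sub>v x" if "y + (- c) \<cdot>\<^sub>v x = 0\<^sub>v (2 * r)"
      proof (rule eq_vecI)
        fix i assume "i < dim_vec (c \<cdot>\<^sub>v x)"
        then have "(y + (- c) \<cdot>\<^sub>v x) $ i = 0" "i < 2 * r" using that car by auto
        then show "y $ i = (c \<cdot>\<^sub>v x) $ i" using car by simp
      qed (use car in auto)
      ultimately have "y + (- c) \<cdot>\<^sub>v x \<noteq> 0\<^sub>v (2 * r)" by blast
      with car have "y + (- c) \<cdot>\<^sub>v x \<in> carrier_vec (2 * r)" "y + (- c) \<cdot>\<^sub>v x \<noteq> 0\<^sub>v (2 * r)"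
        by simp_all
      then obtain v where v: "v \<in> carrier_vec (2 * r)"
        "symplectic_form r (y + (- c) \<cdot>\<^sub>v x) v \<noteq> 0"
        by (rule symplectic_form_nondegenerate)
      then show False
        using y_eq[OF v(1)] car by (simp add: symplectic_form_linear_left)
    qed
    moreover have "0 \<cdot>\<^sub>v x = 0\<^sub>v (2 * r)" using car by (auto intro!: eq_vecI)
    ultimately have "c \<noteq> 0" using car by metis
    then show False using yc neq proj_point_eq_iff[OF x y] by blast
  qed
  then obtain u where u: "u \<in> carrier_vec (2 * r)" "symplectic_form r x u = 0"
    "symplectic_form r y u \<noteq> 0" by blast
  then show ?thesis
    by (intro that[of "inverse (symplectic_form r y u) \<cdot>\<^sub>v u"]) (simp_all add: symplectic_form_linear)
qed

lemma card_symplectic_perp: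
  fixes x :: "'a::{finite,field} vec"
  assumes x: "x \<in> nonzero_vecs (2 * r)"
  shows "card {v \<in> carrier_vec (2 * r). symplectic_form r x v = 0} = CARD('a) ^ (2 * r - 1)"
proof -
  have "r > 0" using x by (cases r) (auto simp: nonzero_vecs_def)
  then have "CARD('a) ^ (2 * r) = CARD('a) ^ (2 * r - 1) * CARD('a)"
    by (simp flip: power_Suc2)
  then show ?thesis
    using card_additive_kernel[OF _ symplectic_form_surj[OF x]]
    by (simp add: symplectic_form_linear)
qed

text \<open>The separating vectors \<open>w\<close> and \<open>u\<close> are dual to the two
  functionals, so the pair map is onto and its kernel has index q^2.\<close>

lemma card_symplectic_perp2:
  fixes x y :: "'a::{finite,field} vec"
  assumes x: "x \<in> nonzero_vecs (2 * r)" and y: "y \<in> nonzero_vecs (2 * r)"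
    and neq: "proj_point x \<noteq> proj_point y"
  shows "card {v \<in> carrier_vec (2 * r). symplectic_form r x v = 0 \<and> symplectic_form r y v = 0} =
    CARD('a) ^ (2 * r - 2)"
proof -
  let ?f = "\<lambda>v. (symplectic_form r x v, symplectic_form r y v)"
  obtain u where u: "u \<in> carrier_vec (2 * r)" "symplectic_form r x u = 0" "symplectic_form r y u = 1"
    using symplectic_form_separates[OF x y neq] .
  obtain w where w: "w \<in> carrier_vec (2 * r)" "symplectic_form r y w = 0" "symplectic_form r x w = 1"
    using symplectic_form_separates[OF y x neq[symmetric]] .
  have "(a, b) \<in> ?f ` carrier_vec (2 * r)" for a b
    using u w by (intro image_eqI[of _ _ "a \<cdot>\<^sub>v w + b \<cdot>\<^sub>v u"]) (simp_all add: symplectic_form_linear)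
  then have surj: "?f ` carrier_vec (2 * r) = UNIV" by auto
  have "r > 0" using x by (cases r) (auto simp: nonzero_vecs_def)
  then have "2 * r = (2 * r - 2) + 2" by simp
  then have "CARD('a) ^ (2 * r) = CARD('a) ^ (2 * r - 2) * (CARD('a) * CARD('a))"
    by (metis power_add power2_eq_square)
  then show ?thesis
    using card_additive_kernel[OF _ surj]
    by (simp add: symplectic_form_linear zero_prod_def)
qed

section \<open>The complement of the symplectic graph\<close>

text \<open>The arc set quantifies existentially over representatives. Changing them multiplies the
  form by a product of scalars, so adjacency can be tested on any chosen ones.\<close>

lemma symplectic_arc_iff:
  assumes x: "x \<in> nonzero_vecs (2 * r)" and y: "y \<in> nonzero_vecs (2 * r)"
  shows "(proj_point x, proj_point y) \<in> parcs (symplectic_graph r) \<longleftrightarrow> symplectic_form r x y \<noteq> 0"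
proof
  have car: "x \<in> carrier_vec (2 * r)" "y \<in> carrier_vec (2 * r)"
    using x y by (auto simp: nonzero_vecs_def)
  assume "symplectic_form r x y \<noteq> 0"
  then have "x \<bullet> (symplectic_mat r *\<^sub>v y) \<noteq> 0" using car by (simp add: symplectic_form_eq)
  then show "(proj_point x, proj_point y) \<in> parcs (symplectic_graph r)"
    using x y by (auto simp: symplectic_graph_def)
next
  assume "(proj_point x, proj_point y) \<in> parcs (symplectic_graph r)"
  then obtain x' y' where xy: "x' \<in> nonzero_vecs (2 * r)" "y' \<in> nonzero_vecs (2 * r)"
      "proj_point x = proj_point x'" "proj_point y = proj_point y'"
      "x' \<bullet> (symplectic_mat r *\<^sub>v y') \<noteq> 0"
    by (auto simp: symplectic_graph_def)
  have car: "x \<in> carrier_vec (2 * r)" "y \<in> carrier_vec (2 * r)"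
    "x' \<in> carrier_vec (2 * r)" "y' \<in> carrier_vec (2 * r)"
    using x y xy by (auto simp: nonzero_vecs_def)
  obtain c d where "x' = c \<cdot>\<^sub>v x" "y' = d \<cdot>\<^sub>v y"
    using proj_point_eq_iff[OF x xy(1)] proj_point_eq_iff[OF y xy(2)] xy by blast
  then show "symplectic_form r x y \<noteq> 0"
    using xy(5) symplectic_form_eq[OF car(3,4)] car
    by (auto simp: symplectic_form_linear symplectic_form_linear_left)
qed

lemma sum_powers_Suc: "(\<Sum>i<Suc n. q ^ i) = 1 + q * (\<Sum>i<n. (q::nat) ^ i)"
  unfolding sum.lessThan_Suc_shift by (simp add: sum_distrib_left)

lemma sum_powers_div: "(q::nat) \<ge> 2 \<Longrightarrow> (q ^ n - 1) div (q - 1) = (\<Sum>i<n. q ^ i)"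
  by (subst sum_powers_mult[symmetric]) simp

text \<open>\<open>m\<close> counts the points of a subspace of codimension 2. For two distinct
  points the common perpendicular space always has \<open>m\<close> points, and it contains the two
  points themselves exactly when they are perpendicular, that is, adjacent in the complement. Hence
  mu = m and lambda = m - 2.\<close>

lemma complement_symplectic_strongly_regular:
  assumes q: "q = CARD('a)" and r: "r \<ge> 1" and m: "m = (\<Sum>i<2 * r - 2. q ^ i)"
  shows "strongly_regular (graph_complement (symplectic_graph r :: 'a::{finite,field} vec set pair_pre_digraph))
    (1 + q + q\<^sup>2 * m) (q * m) (m - 2) m"
proof -
  define V where "V = (nonzero_vecs (2 * r) :: 'a vec set)"
  define G where "G = graph_complement (symplectic_graph r :: 'a vec set pair_pre_digraph)"
  let ?w = "symplectic_form r :: 'a vec \<Rightarrow> _"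
  have verts: "pverts G = proj_point ` V"
    by (simp add: G_def graph_complement_def symplectic_graph_def V_def)
  have arcs: "(proj_point x, proj_point y) \<in> parcs G \<longleftrightarrow> proj_point x \<noteq> proj_point y \<and> ?w x y = 0"
    if "x \<in> V" "y \<in> V" for x y
    using that symplectic_arc_iff[of x r y]
    by (auto simp: G_def graph_complement_def symplectic_graph_def V_def)
  have arcs_sub: "parcs G \<subseteq> pverts G \<times> pverts G" by (auto simp: G_def graph_complement_def)
  have fV: "finite V"
    unfolding V_def nonzero_vecs_def by (rule finite_Diff[OF finite_carrier_vec])
  have "pair_graph G"
  proof
    show fin: "finite (pverts G)" using fV by (simp add: verts)
    show "finite (parcs G)" using arcs_sub fin by (auto intro: finite_subset)
    show "symmetric G"
    proof (unfold symmetric_def, rule symI)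
      fix a b assume ab: "(a, b) \<in> arcs_ends (with_proj G)"
      then obtain x y where "x \<in> V" "y \<in> V" "a = proj_point x" "b = proj_point y"
        using arcs_sub verts by auto
      then show "(b, a) \<in> arcs_ends (with_proj G)"
        using ab arcs[of x y] arcs[of y x] symplectic_form_commute[of r y x] by auto
    qed
  qed (use arcs_sub in \<open>auto simp: G_def graph_complement_def\<close>)
  moreover
  have nb: "neighbors G (proj_point x) = proj_point ` {z \<in> V. ?w x z = 0} - {proj_point x}"
    if "x \<in> V" for x
    using that arcs by (auto simp: neighbors_def verts)
  have Wdiff: "{v \<in> carrier_vec (2 * r). Q v} - {0\<^sub>v (2 * r)} = {z \<in> V. Q z}" for Q
    by (auto simp: V_def nonzero_vecs_def)
  have scale0: "x = c \<cdot>\<^sub>v z \<Longrightarrow> ?w y z = 0 \<Longrightarrow> z \<in> V \<Longrightarrow> ?w y x = 0" for x y z c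
    by (auto simp: symplectic_form_linear V_def nonzero_vecs_def)
  have r': "2 * r = Suc (2 * r - 1)" "2 * r - 1 = Suc (2 * r - 2)" using r by auto
  have powsum: "(\<Sum>i<2 * r - 1. q ^ i) = 1 + q * m" "(\<Sum>i<2 * r. q ^ i) = 1 + q + q\<^sup>2 * m"
  proof -
    show *: "(\<Sum>i<2 * r - 1. q ^ i) = 1 + q * m"
      unfolding m by (subst r'(2)) (rule sum_powers_Suc)
    show "(\<Sum>i<2 * r. q ^ i) = 1 + q + q\<^sup>2 * m"
      by (subst r'(1)) (simp only: sum_powers_Suc *, simp add: algebra_simps power2_eq_square)
  qed
  have "card (pverts G) = 1 + q + q\<^sup>2 * m"
    using card_proj_points[of "carrier_vec (2 * r) :: 'a vec set" "2 * r" "2 * r"] powsum(2)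
    by (simp add: verts V_def nonzero_vecs_def card_carrier_vec q)
  moreover have "card (neighbors G (proj_point x)) = q * m" if x: "x \<in> V" for x
  proof -
    have "card (proj_point ` {z \<in> V. ?w x z = 0}) = (\<Sum>i<2 * r - 1. q ^ i)"
      unfolding Wdiff[symmetric] q
    proof (rule card_proj_points)
      show "card {v \<in> carrier_vec (2 * r). ?w x v = 0} = CARD('a) ^ (2 * r - 1)"
        using x by (simp add: card_symplectic_perp V_def)
    qed (auto simp: symplectic_form_zero symplectic_form_linear)
    then have "card (proj_point ` {z \<in> V. ?w x z = 0}) = 1 + q * m"
      by (simp only: powsum)
    moreover have "proj_point x \<in> proj_point ` {z \<in> V. ?w x z = 0}"
      using x by (simp add: symplectic_form_self)
    ultimately show ?thesis using fV by (simp add: nb[OF x])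
  qed
  moreover have
    "card (neighbors G (proj_point x) \<inter> neighbors G (proj_point y)) =
      (if ?w x y = 0 then m - 2 else m)"
    if x: "x \<in> V" and y: "y \<in> V" and neq: "proj_point x \<noteq> proj_point y" for x y
  proof -
    let ?Z = "{z \<in> V. ?w x z = 0 \<and> ?w y z = 0}"
    have card_Z: "card (proj_point ` ?Z) = m"
      unfolding Wdiff[symmetric] m q
    proof (rule card_proj_points)
      show "card {v \<in> carrier_vec (2 * r). ?w x v = 0 \<and> ?w y v = 0} = CARD('a) ^ (2 * r - 2)"
        using x y neq by (intro card_symplectic_perp2) (auto simp: V_def)
    qed (auto simp: symplectic_form_zero symplectic_form_linear)
    \<comment> \<open>A point in both neighbourhoods may come with two different representatives;
      this allows one of them to serve for both conditions.\<close>
    have transfer: "?w a z' = 0"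
      if "z \<in> V" "z' \<in> V" "proj_point z = proj_point z'" "?w a z = 0" for a z z'
      using that proj_point_eq_iff[of z "2 * r" z'] scale0[of z' _ z a] by (auto simp: V_def)
    have nbs: "neighbors G (proj_point x) \<inter> neighbors G (proj_point y) =
        proj_point ` ?Z - {proj_point x, proj_point y}"
      unfolding nb[OF x] nb[OF y]
    proof (intro equalityI subsetI)
      fix p assume p: "p \<in> (proj_point ` {z \<in> V. ?w x z = 0} - {proj_point x}) \<inter>
        (proj_point ` {z \<in> V. ?w y z = 0} - {proj_point y})"
      then obtain z z' where z: "z \<in> V" "?w x z = 0" "p = proj_point z"
        "z' \<in> V" "?w y z' = 0" "p = proj_point z'" by auto
      then have "?w y z = 0" using transfer[of z' z y] by simp
      then show "p \<in> proj_point ` ?Z - {proj_point x, proj_point y}" using p z by auto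
    qed auto
    \<comment> \<open>The form is alternating, so \<open>x\<close> is perpendicular to itself and
      only the condition from \<open>y\<close> remains.\<close>
    have xm: "proj_point x \<in> proj_point ` ?Z \<longleftrightarrow> ?w y x = 0"
      using x transfer[of _ x y] by (auto simp: symplectic_form_self)
    have ym: "proj_point y \<in> proj_point ` ?Z \<longleftrightarrow> ?w x y = 0"
      using y transfer[of _ y x] by (auto simp: symplectic_form_self)
    show ?thesis
    proof (cases "?w x y = 0")
      case True
      then have "{proj_point x, proj_point y} \<subseteq> proj_point ` ?Z"
        using xm ym symplectic_form_commute[of r y x] by simp
      then show ?thesis using True neq by (simp add: nbs card_Diff_subset card_Z)
    next
      case False
      then have "proj_point ` ?Z - {proj_point x, proj_point y} = proj_point ` ?Z"
        using xm ym symplectic_form_commute[of r y x] by auto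
      then show ?thesis using False by (simp add: nbs card_Z)
    qed
  qed
  ultimately show ?thesis
    unfolding G_def[symmetric] strongly_regular_def
    by (auto simp: verts arcs)
qed

section \<open>Matching the parameters of both families\<close>

theorem mainTheorem6:
  fixes q :: nat
  assumes "primepow q"
  shows
    "(\<forall>r\<ge>2. CARD('a::{finite,field}) = q \<longrightarrow>
        strongly_regular (graph_complement (symplectic_graph r :: 'a vec set pair_pre_digraph))
          ((q ^ (2 * r) - 1) div (q - 1))
          ((q ^ (2 * r - 1) - q) div (q - 1))
          ((q ^ (2 * r - 2) - 1) div (q - 1) - 2)
          ((q ^ (2 * r - 2) - 1) div (q - 1)) \<and>
        Brouwer_conjecture
          (graph_complement (symplectic_graph r :: 'a vec set pair_pre_digraph))) \<and>
     (\<forall>(P :: 'p set) L. generalized_quadrangle q q P L \<longrightarrow>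
        strongly_regular (point_graph P L)
          ((q + 1) * (q ^ 2 + 1)) (q * (q + 1)) (q - 1) (q + 1) \<and>
        Brouwer_conjecture (point_graph P L))"
proof (intro conjI allI impI)
  have q: "q \<ge> 2" using primepow_gt_Suc_0[OF assms] by simp
  {
    fix r :: nat
    assume r: "r \<ge> 2" and card: "CARD('a) = q"
    define m where "m = (\<Sum>i<2 * r - 2. q ^ i)"
    let ?G = "graph_complement (symplectic_graph r :: 'a vec set pair_pre_digraph)"
    have srg: "strongly_regular ?G (1 + q + q\<^sup>2 * m) (q * m) (m - 2) m"
      using r m_def by (intro complement_symplectic_strongly_regular) (simp_all add: card)
    have r': "2 * r = Suc (2 * r - 1)" "2 * r - 1 = Suc (2 * r - 2)" using r by auto
    have k: "(\<Sum>i<2 * r - 1. q ^ i) = 1 + q * m"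
      unfolding m_def by (subst r'(2)) (rule sum_powers_Suc)
    have v: "(\<Sum>i<2 * r. q ^ i) = 1 + q + q\<^sup>2 * m"
      by (subst r'(1)) (simp only: sum_powers_Suc k, simp add: algebra_simps power2_eq_square)
    have "q ^ (2 * r - 1) = q * q ^ (2 * r - 2)" by (subst r'(2)) simp
    then have "q ^ (2 * r - 1) - q = q * (q ^ (2 * r - 2) - 1)"
      by (simp add: right_diff_distrib')
    also have "q ^ (2 * r - 2) - 1 = (q - 1) * m"
      unfolding m_def by (rule sum_powers_mult[symmetric])
    finally have k': "(q ^ (2 * r - 1) - q) div (q - 1) = q * m"
      using q by simp
    show "strongly_regular ?G
          ((q ^ (2 * r) - 1) div (q - 1))
          ((q ^ (2 * r - 1) - q) div (q - 1))
          ((q ^ (2 * r - 2) - 1) div (q - 1) - 2)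
          ((q ^ (2 * r - 2) - 1) div (q - 1))"
      using srg unfolding k' sum_powers_div[OF q] v m_def[symmetric] .
    \<comment> \<open>From \<open>r \<ge> 2\<close> the sum \<open>m\<close> contains 1 + q, so
      \<open>m - 2\<close> is not truncated.\<close>
    have "(\<Sum>i<2. q ^ i) \<le> m"
      unfolding m_def using r by (intro sum_mono2) auto
    then have m2: "m - 2 + 2 = m" using q by (simp add: numeral_2_eq_2)
    show "Brouwer_conjecture ?G"
      by (rule Brouwer_conjectureI[of ?G q "m - 2", unfolded m2, OF srg q])
  next
    fix P :: "'p set" and L
    assume "generalized_quadrangle q q P L"
    from generalized_quadrangle_strongly_regular[OF this]
    show srg: "strongly_regular (point_graph P L)
          ((q + 1) * (q ^ 2 + 1)) (q * (q + 1)) (q - 1) (q + 1)"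
      by (simp add: power2_eq_square)
    \<comment> \<open>For order (s,t), lambda + 2 = mu reads s + 1 = t + 1. Thus equal orders are
      what the criterion requires, and then k = s(t + 1) is q mu.\<close>
    have "(q + 1) * (q ^ 2 + 1) = 1 + q + q\<^sup>2 * (q - 1 + 2)" "q + 1 = q - 1 + 2"
      using q by (simp_all add: algebra_simps)
    then show "Brouwer_conjecture (point_graph P L)"
      using Brouwer_conjectureI[of "point_graph P L" q "q - 1"] srg q by metis
  }
qed

end
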